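(* Let $X$ be a graph with bounded valency and finite Assouad–Nagata dimension. Then $\mathrm{sep}_X(n)\preceq n/\log(n)$. If, moreover, $X$ is vertex transitive and there are constants $C,d>0$ such that the growth function of $X$ satisfies $\gamma_X(n)\le Cn^d$ for all $n\ge 1$, then $\mathrm{sep}_X(n)\preceq n^{(d-1)/d}$.
   Context: A graph is regarded as a metric space via its vertex set with the shortest path metric (vertices in different components being at infinite distance). Bounded valency means vertex degrees are uniformly bounded. A metric space $X$ has Assouad–Nagata dimension at most $m$ if there is a constant $C>0$ such that for all $r>0$ one can partition $X$ into $m+1$ subsets $X_0,\dots,X_m$ and each $X_i$ into sets $X_{i,j}$ with $\mathrm{diam}(X_{i,j})\le Cr$ and $d(X_{i,j},X_{i,j'})>r$ whenever $j\ne j'$. It has finite Assouad–Nagata dimension if this holds for some $m\in\mathbb{N}$. The growth function $\gamma_X(n)$ is the maximal cardinality of a closed ball of radius $n$ in $X$. For a finite graph $\Gamma$ with $n$ vertices, the cut size $\mathrm{cut}(\Gamma)$ is the minimal cardinality of a set $S$ of vertices such that every connected component of $\Gamma\setminus S$ has at most $n/2$ vertices. The separation profile $\mathrm{sep}_X(n)$ is the maximum of $\mathrm{cut}(\Gamma)$ over all subgraphs $\Gamma$ of $X$ with at most $n$ vertices. For functions $f,g$ on $\mathbb{N}$, $f\preceq g$ means there is a constant $C$ such that $f(n)\le Cg(n)+C$ for all $n$ (for $n\ge 2$ when $g(n)=n/\log n$). *)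

theory Defs
  imports Complex_Main "HOL-Library.Disjoint_Sets" "HOL-Library.Extended_Nonnegative_Real"
begin

text \<open>
  A graph is given by a vertex set \<open>V\<close>, possibly infinite, and a set \<open>E\<close> of unordered pairs of
  distinct vertices.
\<close>

definition simple_graph :: "'a set \<Rightarrow> 'a set set \<Rightarrow> bool" where
  "simple_graph V E \<longleftrightarrow> (\<forall>e\<in>E. \<exists>u\<in>V. \<exists>v\<in>V. u \<noteq> v \<and> e = {u, v})"

definition graph_walk :: "'a set \<Rightarrow> 'a set set \<Rightarrow> 'a \<Rightarrow> 'a list \<Rightarrow> 'a \<Rightarrow> bool" where
  "graph_walk V E u p v \<longleftrightarrow>
     p \<noteq> [] \<and> hd p = u \<and> last p = v \<and> set p \<subseteq> V \<and> successively (\<lambda>x y. {x, y} \<in> E) p"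

text \<open>The infimum over the empty set is \<open>\<infinity>\<close>: vertices in different components are at infinite distance.\<close>

definition graph_dist :: "'a set \<Rightarrow> 'a set set \<Rightarrow> 'a \<Rightarrow> 'a \<Rightarrow> ennreal" where
  "graph_dist V E u v = (INF p\<in>{p. graph_walk V E u p v}. of_nat (length p - 1))"

definition bounded_valency :: "'a set \<Rightarrow> 'a set set \<Rightarrow> bool" where
  "bounded_valency V E \<longleftrightarrow>
     (\<exists>D. \<forall>v\<in>V. finite {u. {v, u} \<in> E} \<and> card {u. {v, u} \<in> E} \<le> D)"

definition vertex_transitive :: "'a set \<Rightarrow> 'a set set \<Rightarrow> bool" where
  "vertex_transitive V E \<longleftrightarrow>
     (\<forall>u\<in>V. \<forall>v\<in>V. \<exists>f. bij_betw f V V \<and>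
        (\<forall>x\<in>V. \<forall>y\<in>V. {x, y} \<in> E \<longleftrightarrow> {f x, f y} \<in> E) \<and> f u = v)"

text \<open>Assouad--Nagata dimension of a set \<open>X\<close> with an extended metric \<open>\<delta>\<close>.\<close>

definition ext_diam :: "('a \<Rightarrow> 'a \<Rightarrow> ennreal) \<Rightarrow> 'a set \<Rightarrow> ennreal" where
  "ext_diam \<delta> A = (SUP x\<in>A. SUP y\<in>A. \<delta> x y)"

definition ext_setdist :: "('a \<Rightarrow> 'a \<Rightarrow> ennreal) \<Rightarrow> 'a set \<Rightarrow> 'a set \<Rightarrow> ennreal" where
  "ext_setdist \<delta> A B = (INF x\<in>A. INF y\<in>B. \<delta> x y)"

text \<open>
  Some of the \<open>m + 1\<close> classes \<open>Y i\<close> may be empty; \<open>P i\<close> is the set of pieces of \<open>Y i\<close>.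
\<close>

definition assouad_nagata_dim_le :: "'a set \<Rightarrow> ('a \<Rightarrow> 'a \<Rightarrow> ennreal) \<Rightarrow> nat \<Rightarrow> bool" where
  "assouad_nagata_dim_le X \<delta> m \<longleftrightarrow>
     (\<exists>C::real. C > 0 \<and> (\<forall>r::real. r > 0 \<longrightarrow>
        (\<exists>(Y :: nat \<Rightarrow> 'a set) (P :: nat \<Rightarrow> 'a set set).
           (\<Union>i\<le>m. Y i) = X \<and> disjoint_family_on Y {..m} \<and>
           (\<forall>i\<le>m. partition_on (Y i) (P i) \<and>
              (\<forall>A\<in>P i. ext_diam \<delta> A \<le> ennreal (C * r)) \<and>
              (\<forall>A\<in>P i. \<forall>B\<in>P i. A \<noteq> B \<longrightarrow> ext_setdist \<delta> A B > ennreal r)))))"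

definition finite_assouad_nagata_dim :: "'a set \<Rightarrow> ('a \<Rightarrow> 'a \<Rightarrow> ennreal) \<Rightarrow> bool" where
  "finite_assouad_nagata_dim X \<delta> \<longleftrightarrow> (\<exists>m. assouad_nagata_dim_le X \<delta> m)"

text \<open>
  The suprema of natural numbers in \<open>graph_growth\<close> and \<open>sep_profile\<close> are maxima of finite sets:
  for the former, bounded valency bounds the size of the balls of a given radius; for the latter,
  the cut size is at most the number of vertices.
\<close>

definition graph_growth :: "'a set \<Rightarrow> 'a set set \<Rightarrow> nat \<Rightarrow> nat" where
  "graph_growth V E n = (SUP x\<in>V. card {y\<in>V. graph_dist V E x y \<le> of_nat n})"

definition graph_components :: "'a set \<Rightarrow> 'a set set \<Rightarrow> 'a set set" where
  "graph_components V E = V // {(u, v). \<exists>p. graph_walk V E u p v}"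

text \<open>The candidate \<open>S = V\<close> is always admissible, so the infimum is attained.\<close>

definition cut_size :: "'a set \<Rightarrow> 'a set set \<Rightarrow> nat" where
  "cut_size V E =
     (INF S\<in>{S. S \<subseteq> V \<and> (\<forall>K\<in>graph_components (V - S) {e\<in>E. e \<inter> S = {}}.
                          real (card K) \<le> real (card V) / 2)}. card S)"

text \<open>Subgraphs need not be induced.\<close>

definition sep_profile :: "'a set \<Rightarrow> 'a set set \<Rightarrow> nat \<Rightarrow> nat" where
  "sep_profile V E n =
     (SUP (W, F)\<in>{(W, F). W \<subseteq> V \<and> F \<subseteq> E \<and> simple_graph W F \<and> finite W \<and> card W \<le> n}.
        cut_size W F)"

text \<open>The relation \<open>f \<preceq> g\<close>, with the range \<open>N\<close> of the argument made explicit.\<close>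

definition preceq_on :: "nat set \<Rightarrow> (nat \<Rightarrow> real) \<Rightarrow> (nat \<Rightarrow> real) \<Rightarrow> bool" where
  "preceq_on N f g \<longleftrightarrow> (\<exists>C::real. \<forall>n\<in>N. f n \<le> C * g n + C)"

end

theory Submission
  imports Defs
begin

text \<open>
  Take a cover at scale \<open>r = 2s\<close> with classes \<open>Y i\<close>, \<open>i \<le> m\<close>. For each \<open>i\<close> the \<open>s\<close> layers of
  vertices at distance \<open>1, \<dots>, s\<close> from \<open>Y i\<close> are disjoint, so one of them meets a finite subgraph
  with \<open>N\<close> vertices in at most \<open>N / s\<close> points. Deleting such a layer for every \<open>i\<close> removes at most
  \<open>(m + 1) N / s\<close> vertices, and since the pieces of \<open>Y i\<close> are more than \<open>2s\<close> apart, every remaining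
  component is trapped in the \<open>s\<close>-neighbourhood of a single piece, hence in a ball of radius \<open>M s\<close>.
  It remains to choose \<open>s\<close> as large as possible with such balls having at most \<open>N / 2\<close> vertices:
  \<open>s\<close> is of order \<open>ln n\<close> under exponential growth, and of order \<open>N powr (1 / d)\<close> under polynomial
  growth.
\<close>

section \<open>Iterated neighbourhoods and the path metric\<close>

primrec nbhd :: "'a set set \<Rightarrow> nat \<Rightarrow> 'a set \<Rightarrow> 'a set" where
  "nbhd E 0 A = A"
| "nbhd E (Suc k) A = nbhd E k A \<union> {u. \<exists>v\<in>nbhd E k A. {v, u} \<in> E}"

lemma nbhd_add: "nbhd E (j + k) A = nbhd E j (nbhd E k A)"
  by (induction j) auto

lemma nbhd_mono: "A \<subseteq> B \<Longrightarrow> nbhd E k A \<subseteq> nbhd E k B"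
  by (induction k) auto

lemma nbhd_mono_radius: "j \<le> k \<Longrightarrow> nbhd E j A \<subseteq> nbhd E k A"
  by (induction k rule: dec_induct) auto

lemma nbhd_UN: "nbhd E k (\<Union>i\<in>I. A i) = (\<Union>i\<in>I. nbhd E k (A i))"
  by (induction k) auto

lemma nbhd_pointwise: "x \<in> nbhd E k A \<longleftrightarrow> (\<exists>a\<in>A. x \<in> nbhd E k {a})"
  using nbhd_UN[of E k "\<lambda>a. {a}" A] by auto

lemma nbhd_trans: "y \<in> nbhd E j {x} \<Longrightarrow> z \<in> nbhd E k {y} \<Longrightarrow> z \<in> nbhd E (j + k) {x}"
  using nbhd_mono[of "{y}" "nbhd E j {x}" E k] nbhd_add[of E k j "{x}"] by (auto simp: add.commute)

lemma nbhd_edge: "{x, y} \<in> E \<Longrightarrow> y \<in> nbhd E 1 {x}"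
  by auto

text \<open>Edges are unordered, so the last edge on the way from \<open>y\<close> to
  \<open>x\<close> is the first one on the way back.\<close>

lemma nbhd_sym: "x \<in> nbhd E k {y} \<Longrightarrow> y \<in> nbhd E k {x}"
proof (induction k arbitrary: x)
  case (Suc k)
  show ?case
  proof (cases "x \<in> nbhd E k {y}")
    case True
    then show ?thesis using Suc.IH by simp
  next
    case False
    then obtain w where w: "w \<in> nbhd E k {y}" "{w, x} \<in> E"
      using Suc.prems by auto
    then have "w \<in> nbhd E 1 {x}"
      by (intro nbhd_edge) (simp add: insert_commute)
    with Suc.IH[OF w(1)] nbhd_trans[of w E 1 x y k] show ?thesis by simp
  qed
qed auto

lemma simple_graph_edge:
  assumes "simple_graph V E" "{x, y} \<in> E"
  shows "x \<in> V" "y \<in> V"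
proof -
  obtain u v where "u \<in> V" "v \<in> V" "{x, y} = {u, v}"
    using assms unfolding simple_graph_def by blast
  then show "x \<in> V" "y \<in> V" by (auto simp: doubleton_eq_iff)
qed

lemma nbhd_subset:
  assumes "simple_graph V E" "A \<subseteq> V"
  shows "nbhd E k A \<subseteq> V"
  using assms by (induction k) (auto dest: simple_graph_edge)

lemma last_in_nbhd:
  "successively (\<lambda>x y. {x, y} \<in> E) (x # p) \<Longrightarrow> last (x # p) \<in> nbhd E (length p) {x}"
proof (induction p arbitrary: x)
  case (Cons y p)
  then have "y \<in> nbhd E 1 {x}" "last (y # p) \<in> nbhd E (length p) {y}"
    by auto
  from nbhd_trans[OF this] show ?case by simp
qed auto

lemma nbhd_imp_walk:
  assumes "simple_graph V E" "u \<in> V" "v \<in> nbhd E k {u}"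
  shows "\<exists>p. graph_walk V E u p v \<and> length p \<le> Suc k"
  using assms(3)
proof (induction k arbitrary: v)
  case 0
  then have "graph_walk V E u [u] v" using assms(2) by (simp add: graph_walk_def)
  then show ?case by fastforce
next
  case (Suc k)
  show ?case
  proof (cases "v \<in> nbhd E k {u}")
    case True
    then show ?thesis using Suc.IH le_SucI by blast
  next
    case False
    then obtain w where w: "w \<in> nbhd E k {u}" "{w, v} \<in> E"
      using Suc.prems by auto
    obtain p where p: "graph_walk V E u p w" "length p \<le> Suc k"
      using Suc.IH[OF w(1)] by blast
    have "graph_walk V E u (p @ [v]) v"
      using p(1) w(2) simple_graph_edge(2)[OF assms(1) w(2)]
      by (auto simp: graph_walk_def successively_append_iff)
    then show ?thesis using p(2) by fastforce
  qed
qed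

text \<open>This is the bridge from \<open>ennreal\<close> distances to balls built step by step.
  All later geometry uses radii in \<open>nat\<close>; the metric itself appears only where
  diameters and separations of a cover are read off.\<close>

lemma graph_dist_le_iff:
  assumes "simple_graph V E" "u \<in> V"
  shows "graph_dist V E u v \<le> of_nat k \<longleftrightarrow> v \<in> nbhd E k {u}"
proof
  assume "v \<in> nbhd E k {u}"
  then obtain p where p: "graph_walk V E u p v" "length p \<le> Suc k"
    using nbhd_imp_walk[OF assms] by blast
  have "graph_dist V E u v \<le> of_nat (length p - 1)"
    unfolding graph_dist_def using p(1) by (intro INF_lower) auto
  also have "\<dots> \<le> of_nat k" using p(2) by auto
  finally show "graph_dist V E u v \<le> of_nat k" .
next
  assume le: "graph_dist V E u v \<le> of_nat k"
  have "\<exists>p. graph_walk V E u p v \<and> length p - 1 \<le> k"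
  proof (rule ccontr)
    assume "\<not> ?thesis"
    \<comment> \<open>Lengths are integers, so missing the bound \<open>k\<close> means missing it
      by one. This keeps the infimum away from \<open>k\<close>, also when there is no walk and it
      is infinite.\<close>
    then have "of_nat (Suc k) \<le> graph_dist V E u v"
      unfolding graph_dist_def by (intro INF_greatest of_nat_mono) force
    from order_trans[OF this le] have "(of_nat (Suc k) :: ennreal) \<le> of_nat k" .
    then show False by (simp only: of_nat_le_iff)
  qed
  then obtain p where p: "graph_walk V E u p v" "length p - 1 \<le> k"
    by blast
  from p(1) obtain q where "p = u # q" "last (u # q) = v" "successively (\<lambda>x y. {x, y} \<in> E) (u # q)"
    by (cases p) (auto simp: graph_walk_def)
  with last_in_nbhd[of E u q] have "v \<in> nbhd E (length p - 1) {u}"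
    by simp
  then show "v \<in> nbhd E k {u}"
    using nbhd_mono_radius[OF p(2), of E "{u}"] by auto
qed

lemma graph_ball_eq_nbhd:
  assumes "simple_graph V E" "u \<in> V"
  shows "{y \<in> V. graph_dist V E u y \<le> of_nat k} = nbhd E k {u}"
  using nbhd_subset[OF assms(1), of "{u}" k] assms(2) by (auto simp: graph_dist_le_iff[OF assms])

text \<open>Each step adds at most \<open>D\<close> neighbours per vertex already reached, hence
  multiplies the size by at most \<open>D + 1\<close>.\<close>

lemma nbhd_card:
  assumes "simple_graph V E"
    and deg: "\<And>v. v \<in> V \<Longrightarrow> finite {u. {v, u} \<in> E} \<and> card {u. {v, u} \<in> E} \<le> D"
    and "v \<in> V"
  shows "finite (nbhd E k {v}) \<and> card (nbhd E k {v}) \<le> (D + 1) ^ k"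
proof (induction k)
  case (Suc k)
  let ?B = "nbhd E k {v}"
  have sub: "?B \<subseteq> V" using nbhd_subset[OF assms(1)] assms(3) by simp
  have eq: "nbhd E (Suc k) {v} = ?B \<union> (\<Union>w\<in>?B. {u. {w, u} \<in> E})" by auto
  have "card (\<Union>w\<in>?B. {u. {w, u} \<in> E}) \<le> (\<Sum>w\<in>?B. card {u. {w, u} \<in> E})"
    using Suc by (intro card_UN_le) auto
  also have "\<dots> \<le> (\<Sum>w\<in>?B. D)"
    using deg sub by (intro sum_mono) auto
  finally have "card (nbhd E (Suc k) {v}) \<le> card ?B + card ?B * D"
    unfolding eq using card_Un_le[of ?B "\<Union>w\<in>?B. {u. {w, u} \<in> E}"] by simp
  also have "\<dots> = card ?B * (D + 1)" by simp
  also have "\<dots> \<le> (D + 1) ^ k * (D + 1)" using Suc by (intro mult_right_mono) auto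
  finally have "card (nbhd E (Suc k) {v}) \<le> (D + 1) ^ Suc k" by (simp add: mult.commute)
  moreover have "finite (nbhd E (Suc k) {v})"
    unfolding eq using Suc deg sub by auto
  ultimately show ?case by simp
qed auto

section \<open>Components, cuts and separators obtained from covers\<close>

lemma graph_walk_invariant:
  assumes "graph_walk W F u p v" "u \<in> Q"
    and "\<And>x y. x \<in> Q \<Longrightarrow> y \<in> W \<Longrightarrow> {x, y} \<in> F \<Longrightarrow> y \<in> Q"
  shows "v \<in> Q"
proof -
  have "successively (\<lambda>x y. {x, y} \<in> F) (x # q) \<Longrightarrow> set (x # q) \<subseteq> W \<Longrightarrow> x \<in> Q \<Longrightarrow> last (x # q) \<in> Q"
    for x q
  proof (induction q arbitrary: x)
    case (Cons y q)
    have "y \<in> Q" using Cons.prems assms(3)[of x y] by auto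
    then show ?case using Cons.IH[of y] Cons.prems by auto
  qed simp
  from this[of u "tl p"] show ?thesis
    using assms(1,2) by (cases p) (auto simp: graph_walk_def)
qed

lemma cut_size_le:
  assumes "S \<subseteq> W"
    and "\<And>K. K \<in> graph_components (W - S) {e\<in>F. e \<inter> S = {}} \<Longrightarrow> real (card K) \<le> real (card W) / 2"
  shows "cut_size W F \<le> card S"
  unfolding cut_size_def using assms by (intro cINF_lower) auto

lemma cut_size_le_card: "cut_size W F \<le> card W"
  by (rule cut_size_le) (auto simp: graph_components_def)

text \<open>Averaging: otherwise the \<open>s\<close> disjoint parts would together contain more
  than \<open>card W\<close> points of \<open>W\<close>. The product form avoids division in
  \<open>nat\<close>.\<close>

lemma exists_small_part:
  fixes L :: "nat \<Rightarrow> 'a set"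
  assumes "finite W" "s > 0" "disjoint_family_on L {..<s}"
  shows "\<exists>t<s. s * card (W \<inter> L t) \<le> card W"
proof (rule ccontr)
  assume "\<not> ?thesis"
  then have "(\<Sum>t<s. card W) < (\<Sum>t<s. s * card (W \<inter> L t))"
    using assms(2) by (intro sum_strict_mono) (auto simp: not_le)
  also have "\<dots> = s * card (\<Union>t<s. W \<inter> L t)"
    using assms(1,3)
    by (subst card_UN_disjoint) (auto simp: sum_distrib_left disjoint_family_on_def)
  also have "\<dots> \<le> s * card W"
    using assms(1) by (intro mult_left_mono card_mono) auto
  finally show False by simp
qed

text \<open>The inner condition of \<open>assouad_nagata_dim_le\<close>, with the diameter bound
  \<open>R\<close> decoupled from the separation \<open>r\<close> so that \<open>R\<close> can be
  rounded up to a natural number.\<close>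

definition cover_at_scale ::
  "'a set \<Rightarrow> ('a \<Rightarrow> 'a \<Rightarrow> ennreal) \<Rightarrow> nat \<Rightarrow> real \<Rightarrow> real \<Rightarrow> (nat \<Rightarrow> 'a set) \<Rightarrow> (nat \<Rightarrow> 'a set set) \<Rightarrow> bool"
  where "cover_at_scale X \<delta> m R r Y P \<longleftrightarrow>
    (\<Union>i\<le>m. Y i) = X \<and> disjoint_family_on Y {..m} \<and>
    (\<forall>i\<le>m. partition_on (Y i) (P i) \<and>
       (\<forall>A\<in>P i. ext_diam \<delta> A \<le> ennreal R) \<and>
       (\<forall>A\<in>P i. \<forall>B\<in>P i. A \<noteq> B \<longrightarrow> ext_setdist \<delta> A B > ennreal r))"

text \<open>The layers are chosen separately for each class. A component is then controlled through
  any one of its vertices \<open>v\<close>: the deleted layer of the class containing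
  \<open>v\<close> keeps it near the piece \<open>A\<close> of \<open>v\<close>. The radius
  \<open>k + s\<close> is the diameter of \<open>A\<close> plus the width of its
  neighbourhood.\<close>

lemma cut_size_le_of_cover:
  assumes graph: "simple_graph V E"
    and cover: "cover_at_scale V (graph_dist V E) m (real k) (real (2 * s)) Y P"
    and "s > 0"
    and W: "finite W" "W \<subseteq> V" "F \<subseteq> E"
    and balls: "\<And>v. v \<in> V \<Longrightarrow> finite (nbhd E (k + s) {v}) \<and> 2 * card (nbhd E (k + s) {v}) \<le> card W"
  shows "s * cut_size W F \<le> (m + 1) * card W"
proof -
  have Y: "(\<Union>i\<le>m. Y i) = V"
    and part: "\<And>i. i \<le> m \<Longrightarrow> partition_on (Y i) (P i)"
    and diam: "\<And>i A. i \<le> m \<Longrightarrow> A \<in> P i \<Longrightarrow> ext_diam (graph_dist V E) A \<le> ennreal (real k)"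
    and sep: "\<And>i A B. i \<le> m \<Longrightarrow> A \<in> P i \<Longrightarrow> B \<in> P i \<Longrightarrow> A \<noteq> B \<Longrightarrow>
      ext_setdist (graph_dist V E) A B > ennreal (real (2 * s))"
    using cover unfolding cover_at_scale_def by auto
  have piece_sub: "A \<subseteq> V" if "i \<le> m" "A \<in> P i" for i A
    using that Y partition_onD1[OF part[OF that(1)]] by auto
  \<comment> \<open>\<open>L i t\<close> is the sphere at distance \<open>Suc t\<close> from
    \<open>Y i\<close>, so \<open>t < s\<close> runs through the distances 1 to
    \<open>s\<close>.\<close>
  define L where "L i t = nbhd E (Suc t) (Y i) - nbhd E t (Y i)" for i t
  have "disjoint_family_on (L i) {..<s}" for i
  proof -
    have "L i t \<inter> L i t' = {}" if "t < t'" for t t'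
      using nbhd_mono_radius[of "Suc t" t' E "Y i"] that unfolding L_def by auto
    then show ?thesis unfolding disjoint_family_on_def by (metis Int_commute linorder_neqE_nat)
  qed
  then have "\<exists>t<s. s * card (W \<inter> L i t) \<le> card W" for i
    using exists_small_part[OF W(1) \<open>s > 0\<close>] by blast
  then obtain \<tau> where \<tau>: "\<And>i. \<tau> i < s" "\<And>i. s * card (W \<inter> L i (\<tau> i)) \<le> card W"
    by metis
  define S where "S = (\<Union>i\<le>m. W \<inter> L i (\<tau> i))"
  have "s * card S \<le> s * (\<Sum>i\<le>m. card (W \<inter> L i (\<tau> i)))"
    unfolding S_def by (intro mult_left_mono card_UN_le) auto
  also have "\<dots> = (\<Sum>i\<le>m. s * card (W \<inter> L i (\<tau> i)))"
    by (simp add: sum_distrib_left)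
  also have "\<dots> \<le> (\<Sum>i\<le>m. card W)"
    using \<tau>(2) by (intro sum_mono) auto
  finally have card_S: "s * card S \<le> (m + 1) * card W" by simp
  have "cut_size W F \<le> card S"
  proof (rule cut_size_le)
    show "S \<subseteq> W" unfolding S_def by auto
    fix K assume "K \<in> graph_components (W - S) {e\<in>F. e \<inter> S = {}}"
    then obtain v where v: "v \<in> W - S"
      and K: "K = {u. \<exists>p. graph_walk (W - S) {e\<in>F. e \<inter> S = {}} v p u}"
      unfolding graph_components_def by (auto simp: quotient_def)
    have "v \<in> V" using v W by auto
    then obtain i where i: "i \<le> m" "v \<in> Y i" using Y by auto
    then obtain A where A: "A \<in> P i" "v \<in> A"
      using partition_onD1[OF part[OF i(1)]] by auto
    \<comment> \<open>A step leaving the \<open>\<tau> i\<close>-neighbourhood of \<open>A\<close>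
      would have to land either in the deleted layer or near another piece of the same class, which
      the separation excludes.\<close>
    have stay: "y \<in> nbhd E (\<tau> i) A"
      if x: "x \<in> nbhd E (\<tau> i) A" and y: "y \<in> W - S" and xy: "{x, y} \<in> E" for x y
    proof -
      have y1: "y \<in> nbhd E (Suc (\<tau> i)) A" using x xy by auto
      also have "\<dots> \<subseteq> nbhd E (Suc (\<tau> i)) (Y i)"
        using A(1) partition_onD1[OF part[OF i(1)]] by (intro nbhd_mono) auto
      finally have "y \<in> nbhd E (\<tau> i) (Y i)"
        using y i(1) unfolding S_def L_def by auto
      then obtain b where b: "b \<in> Y i" "y \<in> nbhd E (\<tau> i) {b}"
        by (subst (asm) nbhd_pointwise) auto
      obtain B where B: "B \<in> P i" "b \<in> B"
        using partition_onD1[OF part[OF i(1)]] b(1) by auto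
      obtain a where a: "a \<in> A" "y \<in> nbhd E (Suc (\<tau> i)) {a}"
        using y1 by (subst (asm) nbhd_pointwise) auto
      have "A = B"
      proof (rule ccontr)
        assume "A \<noteq> B"
        have "b \<in> nbhd E (Suc (\<tau> i) + \<tau> i) {a}"
          by (rule nbhd_trans[OF a(2) nbhd_sym[OF b(2)]])
        \<comment> \<open>The path from \<open>a\<close> through \<open>y\<close> to
          \<open>b\<close> has length at most \<open>2 * \<tau> i + 1\<close>, which is below
          \<open>2 * s\<close> because \<open>\<tau> i < s\<close>.\<close>
        also have "\<dots> \<subseteq> nbhd E (2 * s) {a}"
          using \<tau>(1)[of i] by (intro nbhd_mono_radius) simp
        finally have "graph_dist V E a b \<le> of_nat (2 * s)"
          using graph_dist_le_iff[OF graph] piece_sub[OF i(1) A(1)] a(1) by blast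
        then have "ext_setdist (graph_dist V E) A B \<le> of_nat (2 * s)"
          unfolding ext_setdist_def by (intro INF_lower2[OF a(1)] INF_lower2[OF B(2)])
        with sep[OF i(1) A(1) B(1) \<open>A \<noteq> B\<close>] show False
          unfolding ennreal_of_nat_eq_real_of_nat by order
      qed
      then show ?thesis using B(2) b(2) nbhd_mono[of "{b}" A E "\<tau> i"] by auto
    qed
    have "K \<subseteq> nbhd E (k + s) {v}"
    proof
      fix u assume "u \<in> K"
      then obtain p where p: "graph_walk (W - S) {e\<in>F. e \<inter> S = {}} v p u" using K by auto
      have "u \<in> nbhd E (\<tau> i) A"
      proof (rule graph_walk_invariant[OF p])
        show "v \<in> nbhd E (\<tau> i) A" using nbhd_mono_radius[of 0 "\<tau> i" E A] A(2) by auto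
      qed (use stay W(3) in auto)
      then obtain a where a: "a \<in> A" "u \<in> nbhd E (\<tau> i) {a}"
        by (subst (asm) nbhd_pointwise) auto
      have "graph_dist V E v a \<le> ext_diam (graph_dist V E) A"
        unfolding ext_diam_def by (intro SUP_upper2[OF A(2)] SUP_upper a(1))
      also have "\<dots> \<le> of_nat k"
        using diam[OF i(1) A(1)] by (simp add: ennreal_of_nat_eq_real_of_nat)
      finally have "a \<in> nbhd E k {v}" using graph_dist_le_iff[OF graph \<open>v \<in> V\<close>] by simp
      from nbhd_trans[OF this a(2)] show "u \<in> nbhd E (k + s) {v}"
        using nbhd_mono_radius[of "k + \<tau> i" "k + s" E "{v}"] \<tau>(1)[of i] by auto
    qed
    then have "2 * card K \<le> card W"
      using balls[OF \<open>v \<in> V\<close>] card_mono[of "nbhd E (k + s) {v}" K] by linarith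
    then show "real (card K) \<le> real (card W) / 2" by linarith
  qed
  then have "s * cut_size W F \<le> s * card S" by simp
  with card_S show ?thesis by linarith
qed

lemma cut_size_le_of_dim:
  assumes graph: "simple_graph V E"
    and dim: "assouad_nagata_dim_le V (graph_dist V E) m"
  shows "\<exists>M>0. \<forall>s>0. \<forall>W F. finite W \<and> W \<subseteq> V \<and> F \<subseteq> E \<and>
      (\<forall>v\<in>V. finite (nbhd E (M * s) {v}) \<and> 2 * card (nbhd E (M * s) {v}) \<le> card W) \<longrightarrow>
    s * cut_size W F \<le> (m + 1) * card W"
proof -
  obtain C :: real where C: "C > 0" and
    *: "\<And>r. r > 0 \<Longrightarrow> \<exists>Y P. cover_at_scale V (graph_dist V E) m (C * r) r Y P"
    using dim unfolding assouad_nagata_dim_le_def cover_at_scale_def by blast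
  \<comment> \<open>At separation \<open>2 * s\<close> the pieces have diameter at most
    \<open>2 * C * s\<close>, hence at most \<open>c * s\<close>; the further \<open>s\<close> for
    the neighbourhood makes \<open>c + 1\<close> the factor \<open>M\<close>, independent of
    \<open>s\<close>.\<close>
  define c where "c = nat \<lceil>2 * C\<rceil>"
  have "s * cut_size W F \<le> (m + 1) * card W"
    if s: "s > 0" and W: "finite W" "W \<subseteq> V" "F \<subseteq> E"
      and balls: "\<forall>v\<in>V. finite (nbhd E ((c + 1) * s) {v}) \<and> 2 * card (nbhd E ((c + 1) * s) {v}) \<le> card W"
    for s W F
  proof -
    obtain Y P where YP: "cover_at_scale V (graph_dist V E) m (C * real (2 * s)) (real (2 * s)) Y P"
      using *[of "real (2 * s)"] s by auto
    have "2 * C \<le> real c" unfolding c_def by linarith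
    then have "2 * C * real s \<le> real c * real s" by (intro mult_right_mono) auto
    then have "C * real (2 * s) \<le> real (c * s)" by simp
    then have "ennreal (C * real (2 * s)) \<le> ennreal (real (c * s))" by (rule ennreal_leI)
    then have "cover_at_scale V (graph_dist V E) m (real (c * s)) (real (2 * s)) Y P"
      using YP unfolding cover_at_scale_def by (meson order_trans)
    from cut_size_le_of_cover[OF graph this s W] show ?thesis
      using balls by (simp add: algebra_simps)
  qed
  then show ?thesis by (intro exI[of _ "c + 1"]) auto
qed

section \<open>The separation profile and the growth function as suprema\<close>

lemma sep_profile_le:
  assumes "\<And>W F. W \<subseteq> V \<Longrightarrow> F \<subseteq> E \<Longrightarrow> finite W \<Longrightarrow> card W \<le> n \<Longrightarrow> real (cut_size W F) \<le> x"
  shows "real (sep_profile V E n) \<le> x"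
proof -
  \<comment> \<open>The empty subgraph shows that \<open>x\<close> is nonnegative, so a bound by its
    floor in \<open>nat\<close> gives back a bound by \<open>x\<close>.\<close>
  have "0 \<le> x" using assms[of "{}" "{}"] by (simp add: order_trans[OF of_nat_0_le_iff])
  have "sep_profile V E n \<le> nat \<lfloor>x\<rfloor>"
    unfolding sep_profile_def
  proof (rule cSUP_least)
    have "({}, {}) \<in> {(W, F). W \<subseteq> V \<and> F \<subseteq> E \<and> simple_graph W F \<and> finite W \<and> card W \<le> n}"
      by (simp add: simple_graph_def)
    then show "{(W, F). W \<subseteq> V \<and> F \<subseteq> E \<and> simple_graph W F \<and> finite W \<and> card W \<le> n} \<noteq> {}"
      by blast
  qed (use assms le_nat_floor in auto)
  then show ?thesis using \<open>0 \<le> x\<close> by linarith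
qed

text \<open>A supremum in \<open>nat\<close> dominates its members only for a bounded set; bounded
  valency supplies the bound, uniformly over all centres.\<close>

lemma nbhd_card_le_growth:
  assumes "simple_graph V E" "bounded_valency V E" "v \<in> V"
  shows "card (nbhd E k {v}) \<le> graph_growth V E k"
proof -
  obtain D where D: "\<And>v. v \<in> V \<Longrightarrow> finite {u. {v, u} \<in> E} \<and> card {u. {v, u} \<in> E} \<le> D"
    using assms(2) unfolding bounded_valency_def by blast
  have "bdd_above ((\<lambda>x. card {y \<in> V. graph_dist V E x y \<le> of_nat k}) ` V)"
    using nbhd_card[OF assms(1) D]
    by (intro bdd_aboveI[of _ "(D + 1) ^ k"]) (auto simp: graph_ball_eq_nbhd[OF assms(1)])
  from cSUP_upper[OF assms(3) this] show ?thesis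
    unfolding graph_growth_def by (simp add: graph_ball_eq_nbhd[OF assms(1,3)])
qed

section \<open>Choosing the scale from the growth rate\<close>

lemma sqrt_le_div_ln:
  assumes "n \<ge> (2::nat)"
  shows "sqrt (real n) \<le> 2 * (real n / ln (real n))"
proof -
  have "ln (real n) = 2 * ln (sqrt (real n))"
    using assms by (simp add: ln_sqrt)
  \<comment> \<open>This is \<open>ln t \<le> t - 1\<close> at \<open>t = sqrt n\<close>.\<close>
  also have "\<dots> \<le> 2 * sqrt (real n)"
    using assms ln_le_minus_one[of "sqrt (real n)"] by simp
  finally have "sqrt (real n) * ln (real n) \<le> sqrt (real n) * (2 * sqrt (real n))"
    by (intro mult_left_mono) auto
  also have "\<dots> = 2 * real n" by simp
  finally show ?thesis using assms by (simp add: field_simps)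
qed

text \<open>Rounding a scale down costs at most a factor 2 once the scale is at least 1: the floor
  is at least 1 and exceeds \<open>x - 1\<close>.\<close>

lemma floor_ge_half: "x \<ge> (1::real) \<Longrightarrow> x / 2 \<le> real (nat \<lfloor>x\<rfloor>)"
proof -
  assume "x \<ge> 1"
  then have "1 \<le> \<lfloor>x\<rfloor>" by simp
  then have "real (nat \<lfloor>x\<rfloor>) \<ge> 1" "real (nat \<lfloor>x\<rfloor>) = of_int \<lfloor>x\<rfloor>" by simp_all
  then show ?thesis using real_of_int_floor_gt_diff_one[of x] by linarith
qed

text \<open>The scale depends on \<open>n\<close> alone, so two cases need the trivial bound by
  \<open>card W\<close>: \<open>n\<close> too small to allow a positive scale, and subgraphs with
  fewer than \<open>2 * sqrt n\<close> vertices, for which \<open>sqrt_le_div_ln\<close> suffices.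
  Here \<open>m\<close> counts the classes.\<close>

lemma sep_profile_exponential_growth:
  assumes M: "\<And>s W F. s > 0 \<Longrightarrow> finite W \<Longrightarrow> W \<subseteq> V \<Longrightarrow> F \<subseteq> E \<Longrightarrow>
      (\<And>v. v \<in> V \<Longrightarrow> 2 * card (nbhd E (M * s) {v}) \<le> card W) \<Longrightarrow>
      s * cut_size W F \<le> m * card W"
    and growth: "\<And>v s. v \<in> V \<Longrightarrow> real (card (nbhd E (M * s) {v})) \<le> b ^ s"
    and "b > 1"
  shows "preceq_on {2..} (\<lambda>n. real (sep_profile V E n)) (\<lambda>n. real n / ln (real n))"
proof -
  have lnb: "ln b > 0" using \<open>b > 1\<close> by simp
  \<comment> \<open>One summand for each of the three cases below.\<close>
  define K where "K = 2 * ln b + 4 * ln b * real m + 4"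
  have "real (cut_size W F) \<le> K * (real n / ln (real n)) + K"
    if n: "n \<ge> 2" and W: "W \<subseteq> V" "F \<subseteq> E" "finite W" "card W \<le> n" for n W F
  proof -
    have lnn: "ln (real n) > 0" using n by simp
    define g where "g = real n / ln (real n)"
    have "g > 0" unfolding g_def using n lnn by simp
    have cut_W: "real (cut_size W F) \<le> real (card W)" using cut_size_le_card by simp
    \<comment> \<open>The solution of \<open>b powr x = sqrt n\<close>: balls at scale
      \<open>s \<le> x\<close> have at most \<open>sqrt n\<close> vertices, half of the size
      required of \<open>W\<close> in the third case.\<close>
    define x where "x = ln (real n) / (2 * ln b)"
    define s where "s = nat \<lfloor>x\<rfloor>"
    consider "x < 1" | "x \<ge> 1" "real (card W) < 2 * sqrt (real n)"
      | "x \<ge> 1" "real (card W) \<ge> 2 * sqrt (real n)" by linarith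
    then have "real (cut_size W F) \<le> (2 * ln b) * g \<or> real (cut_size W F) \<le> 4 * g \<or>
      real (cut_size W F) \<le> (4 * ln b * real m) * g"
    proof cases
      case 1
      have "real n = ln (real n) * g" unfolding g_def using lnn by simp
      also have "\<dots> \<le> (2 * ln b) * g"
        using 1 lnb \<open>g > 0\<close> by (intro mult_right_mono) (auto simp: x_def)
      finally show ?thesis using cut_W W(4) by linarith
    next
      case 2
      then show ?thesis using cut_W sqrt_le_div_ln[OF n] unfolding g_def by linarith
    next
      case 3
      have s: "s > 0" "real s \<le> x" "x / 2 \<le> real s"
        using 3 floor_ge_half[of x] unfolding s_def by linarith+
      have "b ^ s = b powr real s" using \<open>b > 1\<close> by (simp add: powr_realpow)
      also have "\<dots> \<le> b powr x" using s \<open>b > 1\<close> by simp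
      also have "\<dots> = real n powr (1 / 2)"
        using \<open>b > 1\<close> n lnb by (simp add: powr_def x_def)
      also have "\<dots> = sqrt (real n)" by (simp add: powr_half_sqrt)
      finally have "b ^ s \<le> sqrt (real n)" .
      then have "2 * card (nbhd E (M * s) {v}) \<le> card W" if "v \<in> V" for v
        using growth[OF that, of s] 3(2) by linarith
      then have "real (s * cut_size W F) \<le> real (m * card W)"
        using M[OF s(1) W(3,1,2)] by (simp only: of_nat_le_iff)
      also have "\<dots> \<le> real m * real n" using W(4) by (simp add: mult_left_mono)
      finally have "real s * real (cut_size W F) \<le> real m * real n" by simp
      moreover have "x / 2 * real (cut_size W F) \<le> real s * real (cut_size W F)"
        using s by (intro mult_right_mono) auto
      ultimately have "x / 2 * real (cut_size W F) \<le> real m * real n" by linarith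
      then show ?thesis using lnn lnb unfolding x_def g_def by (simp add: field_simps)
    qed
    moreover have "(2 * ln b) * g \<le> K * g" "4 * g \<le> K * g" "(4 * ln b * real m) * g \<le> K * g"
      using lnb \<open>g > 0\<close> by (intro mult_right_mono; simp add: K_def)+
    moreover have "K \<ge> 0" unfolding K_def using lnb by simp
    ultimately show ?thesis unfolding g_def by linarith
  qed
  then have "\<forall>n\<in>{2..}. real (sep_profile V E n) \<le> K * (real n / ln (real n)) + K"
    by (auto intro!: sep_profile_le)
  then show ?thesis unfolding preceq_on_def by blast
qed

text \<open>Here the scale is adapted to the size \<open>N\<close> of the subgraph itself, and the
  resulting bound in \<open>N\<close> is turned into one in \<open>n\<close> only at the
  end.\<close>

lemma sep_profile_polynomial_growth:
  assumes M: "\<And>s W F. s > 0 \<Longrightarrow> finite W \<Longrightarrow> W \<subseteq> V \<Longrightarrow> F \<subseteq> E \<Longrightarrow>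
      (\<And>v. v \<in> V \<Longrightarrow> 2 * card (nbhd E (M * s) {v}) \<le> card W) \<Longrightarrow>
      s * cut_size W F \<le> m * card W"
    and "M > 0"
    and growth: "\<And>v k. v \<in> V \<Longrightarrow> k > 0 \<Longrightarrow> real (card (nbhd E k {v})) \<le> C * real k powr d"
    and "C > 0" "d > 0"
  shows "preceq_on UNIV (\<lambda>n. real (sep_profile V E n)) (\<lambda>n. real n powr ((d - 1) / d))"
proof -
  \<comment> \<open>Chosen so that \<open>x = a * N powr (1 / d)\<close> solves
    \<open>C * (M * x) powr d = N / 2\<close>.\<close>
  define a where "a = (1 / (2 * C)) powr (1 / d) / real M"
  have "a > 0" unfolding a_def using \<open>C > 0\<close> \<open>M > 0\<close> by simp
  \<comment> \<open>The factor 2 in \<open>K1\<close> pays for rounding \<open>x\<close> down;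
    \<open>K2\<close> is the value of \<open>N\<close> at which \<open>x\<close> reaches 1, so it
    bounds all subgraphs too small for a positive scale.\<close>
  define K1 where "K1 = 2 * real m / a"
  define K2 where "K2 = (1 / a) powr d"
  have K: "K1 \<ge> 0" "K2 \<ge> 0" unfolding K1_def K2_def using \<open>a > 0\<close> by auto
  have "real (cut_size W F) \<le> (K1 + K2) * real n powr ((d - 1) / d) + (K1 + K2)"
    if W: "W \<subseteq> V" "F \<subseteq> E" "finite W" "card W \<le> n" for n W F
  proof -
    define N where "N = real (card W)"
    have N: "N \<ge> 0" "N \<le> real n" unfolding N_def using W by auto
    have cut_W: "real (cut_size W F) \<le> N" unfolding N_def using cut_size_le_card by simp
    define x where "x = a * N powr (1 / d)"
    define s where "s = nat \<lfloor>x\<rfloor>"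
    have "real (cut_size W F) \<le> K1 * real n powr ((d - 1) / d) + K1 + K2"
    proof (cases "x < 1")
      case True
      then have "N powr (1 / d) \<le> 1 / a" using \<open>a > 0\<close> unfolding x_def by (simp add: field_simps)
      then have "(N powr (1 / d)) powr d \<le> (1 / a) powr d"
        using \<open>d > 0\<close> by (intro powr_mono2) auto
      then have "N \<le> K2" unfolding K2_def using N \<open>d > 0\<close> by (simp add: powr_powr)
      then show ?thesis using cut_W K by (smt (verit) mult_nonneg_nonneg powr_ge_zero)
    next
      case False
      then have s: "s > 0" "real s \<le> x" "x / 2 \<le> real s"
        using floor_ge_half[of x] unfolding s_def by linarith+
      \<comment> \<open>As \<open>0 powr (1 / d)\<close> is 0, an empty \<open>W\<close> belongs to
        the case \<open>x < 1\<close>.\<close>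
      have "N \<noteq> 0" using False unfolding x_def by auto
      then have N1: "N \<ge> 1" unfolding N_def by simp
      have "real (M * s) \<le> (1 / (2 * C)) powr (1 / d) * N powr (1 / d)"
        using s(2) \<open>M > 0\<close> unfolding x_def a_def by (simp add: field_simps)
      then have "real (M * s) powr d \<le> ((1 / (2 * C)) powr (1 / d) * N powr (1 / d)) powr d"
        using \<open>d > 0\<close> by (intro powr_mono2) auto
      also have "\<dots> = N / (2 * C)"
        using \<open>d > 0\<close> \<open>C > 0\<close> N by (simp add: powr_mult powr_powr)
      finally have "C * real (M * s) powr d \<le> C * (N / (2 * C))"
        using \<open>C > 0\<close> by (intro mult_left_mono) auto
      then have "C * real (M * s) powr d \<le> N / 2" using \<open>C > 0\<close> by simp
      then have "2 * card (nbhd E (M * s) {v}) \<le> card W" if "v \<in> V" for v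
        using growth[OF that, of "M * s"] s(1) \<open>M > 0\<close> unfolding N_def by fastforce
      then have "real (s * cut_size W F) \<le> real (m * card W)"
        using M[OF s(1) W(3,1,2)] by (simp only: of_nat_le_iff)
      then have "real s * real (cut_size W F) \<le> real m * N" unfolding N_def by simp
      moreover have "x / 2 * real (cut_size W F) \<le> real s * real (cut_size W F)"
        using s by (intro mult_right_mono) auto
      ultimately have "x * real (cut_size W F) \<le> 2 * real m * N" by linarith
      then have "real (cut_size W F) \<le> K1 * (N / N powr (1 / d))"
        unfolding x_def K1_def using \<open>a > 0\<close> N1 by (simp add: field_simps)
      also have "N / N powr (1 / d) = N powr ((d - 1) / d)"
        using N1 powr_diff[of N 1 "1 / d"] \<open>d > 0\<close> by (simp add: diff_divide_distrib)
      finally have cut: "real (cut_size W F) \<le> K1 * N powr ((d - 1) / d)" .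
      \<comment> \<open>for \<open>d < 1\<close> the exponent is negative and the bound in terms of \<open>n\<close> would fail\<close>
      have "N powr ((d - 1) / d) \<le> real n powr ((d - 1) / d) + 1"
      proof (cases "d \<ge> 1")
        case True
        then have "N powr ((d - 1) / d) \<le> real n powr ((d - 1) / d)"
          using N by (intro powr_mono2) auto
        then show ?thesis by simp
      next
        case False
        then have "(d - 1) / d \<le> 0" using \<open>d > 0\<close> by (simp add: field_simps)
        then have "N powr ((d - 1) / d) \<le> N powr 0"
          using N1 by (intro powr_mono) auto
        then show ?thesis using N1 by (simp add: add_increasing)
      qed
      then have "K1 * N powr ((d - 1) / d) \<le> K1 * (real n powr ((d - 1) / d) + 1)"
        using K by (intro mult_left_mono)
      then show ?thesis using cut K by (simp add: algebra_simps)
    qed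
    moreover have "0 \<le> K2 * real n powr ((d - 1) / d)" using K by simp
    ultimately show ?thesis by (simp add: algebra_simps)
  qed
  then have "\<forall>n. real (sep_profile V E n) \<le> (K1 + K2) * real n powr ((d - 1) / d) + (K1 + K2)"
    by (auto intro!: sep_profile_le)
  then show ?thesis unfolding preceq_on_def by blast
qed

section \<open>The two bounds on the separation profile\<close>

theorem theorem1p5:
  fixes V :: "'a set" and E :: "'a set set"
  assumes "simple_graph V E"
    and "bounded_valency V E"
    and "finite_assouad_nagata_dim V (graph_dist V E)"
  shows "preceq_on {2..} (\<lambda>n. real (sep_profile V E n)) (\<lambda>n. real n / ln (real n)) \<and>
    (\<forall>C d :: real. vertex_transitive V E \<and> C > 0 \<and> d > 0 \<and>
        (\<forall>n\<ge>1. real (graph_growth V E n) \<le> C * real n powr d) \<longrightarrow>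
      preceq_on UNIV (\<lambda>n. real (sep_profile V E n)) (\<lambda>n. real n powr ((d - 1) / d)))"
proof -
  obtain D where D: "\<And>v. v \<in> V \<Longrightarrow> finite {u. {v, u} \<in> E} \<and> card {u. {v, u} \<in> E} \<le> D"
    using assms(2) unfolding bounded_valency_def by blast
  have ball: "finite (nbhd E k {v}) \<and> card (nbhd E k {v}) \<le> (D + 1) ^ k" if "v \<in> V" for v k
    by (rule nbhd_card[OF assms(1) _ that]) (rule D)
  obtain m where "assouad_nagata_dim_le V (graph_dist V E) m"
    using assms(3) unfolding finite_assouad_nagata_dim_def by blast
  from cut_size_le_of_dim[OF assms(1) this] obtain M where "M > 0" and
    cut: "\<forall>s>0. \<forall>W F. finite W \<and> W \<subseteq> V \<and> F \<subseteq> E \<and>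
      (\<forall>v\<in>V. finite (nbhd E (M * s) {v}) \<and> 2 * card (nbhd E (M * s) {v}) \<le> card W) \<longrightarrow>
    s * cut_size W F \<le> (m + 1) * card W"
    by (elim exE conjE)
  \<comment> \<open>Finiteness of the balls now comes from bounded valency and leaves the
    premises.\<close>
  have M: "s * cut_size W F \<le> (m + 1) * card W"
    if "s > 0" "finite W" "W \<subseteq> V" "F \<subseteq> E"
      and "\<And>v. v \<in> V \<Longrightarrow> 2 * card (nbhd E (M * s) {v}) \<le> card W" for s W F
    by (rule cut[rule_format]) (use that ball in auto)
  \<comment> \<open>\<open>D + 2\<close> instead of \<open>D + 1\<close> keeps \<open>b > 1\<close>
    even when \<open>D = 0\<close>; the power \<open>M\<close> absorbs the factor in the radius
    \<open>M * s\<close>.\<close>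
  define b where "b = real (D + 2) ^ M"
  have "b > 1" unfolding b_def using \<open>M > 0\<close> by (intro one_less_power) auto
  have "real (card (nbhd E (M * s) {v})) \<le> b ^ s" if "v \<in> V" for v s
  proof -
    have "card (nbhd E (M * s) {v}) \<le> (D + 1) ^ (M * s)" using ball[OF that] by simp
    also have "\<dots> \<le> (D + 2) ^ (M * s)" by (intro power_mono) auto
    finally have "real (card (nbhd E (M * s) {v})) \<le> real ((D + 2) ^ (M * s))"
      by (simp only: of_nat_le_iff)
    then show ?thesis unfolding b_def by (simp add: power_mult)
  qed
  then have "preceq_on {2..} (\<lambda>n. real (sep_profile V E n)) (\<lambda>n. real n / ln (real n))"
    using sep_profile_exponential_growth[OF M _ \<open>b > 1\<close>] by blast
  moreover have "preceq_on UNIV (\<lambda>n. real (sep_profile V E n)) (\<lambda>n. real n powr ((d - 1) / d))"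
    if "C > 0" "d > 0" and growth: "\<forall>n\<ge>1. real (graph_growth V E n) \<le> C * real n powr d"
    for C d :: real
  proof (rule sep_profile_polynomial_growth[OF M \<open>M > 0\<close> _ that(1,2)])
    fix v k assume "v \<in> V" "k > (0::nat)"
    then have "real (card (nbhd E k {v})) \<le> real (graph_growth V E k)"
      using nbhd_card_le_growth[OF assms(1,2)] by simp
    also have "\<dots> \<le> C * real k powr d" using growth \<open>k > 0\<close> by simp
    finally show "real (card (nbhd E k {v})) \<le> C * real k powr d" .
  qed
  ultimately show ?thesis by blast
qed

end
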